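(* We have $$S_{7,1}=\mathbb{N}\setminus\{1,2,5\},\quad S_{7,3}=\mathbb{N}\setminus\{1,3,25\},\quad S_{7,5}=\mathbb{N}\setminus\{5,23\}.$$ Also, $$S_{9,1}=\mathbb{N}\setminus\{1,2,3,6,7,11,35,37\},$$ $$S_{9,5}=\mathbb{N}\setminus\{1,3,5,10,12,31,67\},$$ $$S_{9,7}=\mathbb{N}\setminus\{5,6,7,15,29,65\}.$$
   Context: $\mathbb{N}=\{0,1,2,\ldots\}$. For a positive integer $a$ and an integer $b$ with $a\equiv b\pmod 2$, $$S_{a,b}=\left\{\frac{w(aw+b)}2+\frac{x(ax+b)}2+\frac{y(ay+b)}2+\frac{z(az+b)}2:\ w,x,y,z\in\mathbb{Z}\right\}.$$ *)

theory Defs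
  imports Main
begin

text \<open>
  The term \<open>w * (a * w + b)\<close> is even whenever \<open>a\<close> and \<open>b\<close> have the same parity,
  so under the standing assumption on \<open>a\<close> and \<open>b\<close> (\<open>a > 0\<close> and \<open>a \<equiv> b (mod 2)\<close>)
  every division below is exact. The set is a set of integers, to be compared with
  \<open>\<nat>\<close>, the set of nonnegative integers.
\<close>

definition S :: "int \<Rightarrow> int \<Rightarrow> int set" where
  "S a b = {w * (a * w + b) div 2 + x * (a * x + b) div 2
            + y * (a * y + b) div 2 + z * (a * z + b) div 2 | w x y z. True}"

end

theory Submission
  imports Defs
begin

text \<open>
  Since \<open>a\<close> and \<open>b\<close> are odd, \<open>n\<close> lies in \<open>S a b\<close> as soon as \<open>2 n = a s + b t\<close> where \<open>s\<close> is the sum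
  of the squares and \<open>t\<close> the sum of four integers. By Cauchy's lemma, odd \<open>s\<close> and \<open>t\<close> with
  \<open>t\<^sup>2 < 4 s\<close> arise in this way if \<open>4 s - t\<^sup>2\<close>, which is \<open>3\<close> modulo
      \<open>8\<close>, is a sum of three odd squares.
  For large \<open>n\<close> one can choose \<open>\<bar>t\<bar> \<le> a\<close>; the finitely many remaining \<open>n\<close> are checked directly.

  That every positive \<open>m \<equiv> 3 (mod 8)\<close> is a sum of three odd squares (Gauss) is obtained without
  Dirichlet's theorem or ternary forms, by showing that the number \<open>r m\<close> of representations of \<open>m\<close>
  by positive odd \<open>x, y, z\<close> equals the number \<open>C m\<close> of positive odd \<open>(a, b, c)\<close> with
  \<open>a b + b c + c a = m\<close>, and \<open>C m > 0\<close> because of \<open>(1, 1, (m - 1) div 2)\<close>. For odd \<open>k\<close>, both \<open>r\<close> and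
  \<open>C\<close>, summed over \<open>4 k - w\<^sup>2\<close> with \<open>w\<close> positive and odd, give the sum of the divisors of \<open>k\<close>, and
  this determines them recursively.

  For \<open>r\<close> this is Jacobi's count of representations of \<open>4 k\<close> by four odd squares. It follows because
  both sides satisfy the recursion expressing the symmetry of sums of five odd squares; for the
  divisor sum, this is Liouville's identity, proved by the windmill involution.
  For \<open>C\<close>, the solutions of \<open>w\<^sup>2 + a b + b c + c a
      = 4 k\<close> with \<open>w \<noteq> c\<close> are turned into positive solutions of
  \<open>d e + p q = k\<close> subject to linear inequalities, and these are counted in the manner of Liouville
      by
  combining bijections such as \<open>(d, e, p, q) \<mapsto> (d, e + p, p, q - d)\<close>.
\<close>

subsection \<open>Positive solutions of \<open>d e + p q = k\<close>\<close>

definition mixed_quads :: "int \<Rightarrow> (int \<times> int \<times> int \<times> int) set" where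
  "mixed_quads k = {(d, e, p, q). 0 < d \<and> 0 < e \<and> 0 < p \<and> 0 < q \<and> odd d \<and> odd e \<and> even p \<and> odd q
      \<and> d * e + p * q = k}"

definition even_quads :: "int \<Rightarrow> (int \<times> int \<times> int \<times> int) set" where
  "even_quads k = {(d, e, p, q). 0 < d \<and> 0 < e \<and> 0 < p \<and> 0 < q \<and> odd d \<and> odd e \<and> even p \<and> even q
      \<and> d * e + p * q = k}"

lemma factor_le:
  fixes d e p q :: int
  assumes "0 < d" "0 < e" "0 < p" "0 < q"
  shows "d \<le> d * e + p * q" "e \<le> d * e + p * q" "p \<le> d * e + p * q" "q \<le> d * e + p * q"
proof -
  have "d * 1 \<le> d * e" "1 * e \<le> d * e" "p * 1 \<le> p * q" "1 * q \<le> p * q"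
    using assms by (intro mult_mono; simp)+
  moreover have "0 < d * e" "0 < p * q"
    using assms by simp_all
  ultimately show "d \<le> d * e + p * q" "e \<le> d * e + p * q" "p \<le> d * e + p * q" "q \<le> d * e + p * q"
    by linarith+
qed

lemma finite_mixed_quads: "finite (mixed_quads k)"
  by (rule finite_subset[of _ "{0..k} \<times> {0..k} \<times> {0..k} \<times> {0..k}"])
    (auto simp: mixed_quads_def factor_le)

lemma finite_even_quads: "finite (even_quads k)"
  by (rule finite_subset[of _ "{0..k} \<times> {0..k} \<times> {0..k} \<times> {0..k}"])
    (auto simp: even_quads_def factor_le)

text \<open>The maps \<open>i\<close> and \<open>j\<close> have to be mutually inverse only between
  the entries selected by \<open>P\<close> and those selected by \<open>Q\<close>. This suits linear
  substitutions that keep all entries positive only on part of a set.\<close>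

lemma sum_if_reindex:
  fixes f g :: "'a \<Rightarrow> int"
  assumes "finite X" "finite Y"
    and "\<And>x. x \<in> X \<Longrightarrow> P x \<Longrightarrow> j x \<in> Y \<and> Q (j x) \<and> i (j x) = x \<and> g (j x) = f x"
    and "\<And>y. y \<in> Y \<Longrightarrow> Q y \<Longrightarrow> i y \<in> X \<and> P (i y) \<and> j (i y) = y"
  shows "(\<Sum>x\<in>X. if P x then f x else 0) = (\<Sum>y\<in>Y. if Q y then g y else 0)"
proof -
  have "sum f {x \<in> X. P x} = sum g {y \<in> Y. Q y}"
    by (rule sum.reindex_bij_witness[where i = i and j = j]) (use assms in auto)
  then show ?thesis
    using assms by (simp add: sum.inter_filter)
qed

text \<open>The form is preserved because \<open>d * e + p * q = d * (e + p) + p * (q - d)\<close>.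
  As \<open>d\<close> and \<open>q\<close> are odd, \<open>q - d\<close> is even. The image is cut
  out by \<open>p < e\<close>, which is what makes the inverse substitution \<open>e - p\<close>
  positive.\<close>

lemma sum_mixed_to_even:
  "(\<Sum>(d, e, p, q)\<in>mixed_quads k. if d < q then h d (e + p) p (q - d) else 0)
   = (\<Sum>(d, e, p, q)\<in>even_quads k. if p < e then h d e p q else (0::int))"
proof -
  have "(\<Sum>x\<in>mixed_quads k. if (case x of (d, e, p, q) \<Rightarrow> d < q)
      then (case x of (d, e, p, q) \<Rightarrow> h d (e + p) p (q - d)) else 0)
    = (\<Sum>x\<in>even_quads k. if (case x of (d, e, p, q) \<Rightarrow> p < e)
        then (case x of (d, e, p, q) \<Rightarrow> h d e p q) else 0)"
    by (rule sum_if_reindex[OF finite_mixed_quads finite_even_quads,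
        where j = "\<lambda>(d, e, p, q). (d, e + p, p, q - d)"
          and i = "\<lambda>(d, e, p, q). (d, e - p, p, q + d)"])
      (auto simp: mixed_quads_def even_quads_def algebra_simps)
  then show ?thesis
    by (simp add: case_prod_unfold cong del: if_weak_cong)
qed

lemma sum_even_to_mixed:
  "(\<Sum>(d, e, p, q)\<in>even_quads k. if d < q then h d (e + p) p (q - d) else 0)
   = (\<Sum>(d, e, p, q)\<in>mixed_quads k. if p < e then h d e p q else (0::int))"
proof -
  have "(\<Sum>x\<in>even_quads k. if (case x of (d, e, p, q) \<Rightarrow> d < q)
      then (case x of (d, e, p, q) \<Rightarrow> h d (e + p) p (q - d)) else 0)
    = (\<Sum>x\<in>mixed_quads k. if (case x of (d, e, p, q) \<Rightarrow> p < e)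
        then (case x of (d, e, p, q) \<Rightarrow> h d e p q) else 0)"
    by (rule sum_if_reindex[OF finite_even_quads finite_mixed_quads,
        where j = "\<lambda>(d, e, p, q). (d, e + p, p, q - d)"
          and i = "\<lambda>(d, e, p, q). (d, e - p, p, q + d)"])
      (auto simp: mixed_quads_def even_quads_def algebra_simps)
  then show ?thesis
    by (simp add: case_prod_unfold cong del: if_weak_cong)
qed

text \<open>Here \<open>d * e + p * q = (p - d) * q + (e + q) * d\<close>, where
  \<open>e + q\<close> takes over the role of the even entry.\<close>

lemma sum_mixed_to_mixed:
  "(\<Sum>(d, e, p, q)\<in>mixed_quads k. if d < p then h (p - d) q (e + q) d else 0)
   = (\<Sum>(d, e, p, q)\<in>mixed_quads k. if e < p then h d e p q else (0::int))"
proof -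
  have "(\<Sum>x\<in>mixed_quads k. if (case x of (d, e, p, q) \<Rightarrow> d < p)
      then (case x of (d, e, p, q) \<Rightarrow> h (p - d) q (e + q) d) else 0)
    = (\<Sum>x\<in>mixed_quads k. if (case x of (d, e, p, q) \<Rightarrow> e < p)
        then (case x of (d, e, p, q) \<Rightarrow> h d e p q) else 0)"
    by (rule sum_if_reindex[OF finite_mixed_quads finite_mixed_quads,
        where j = "\<lambda>(d, e, p, q). (p - d, q, e + q, d)"
          and i = "\<lambda>(d, e, p, q). (q, p - e, d + q, e)"])
      (auto simp: mixed_quads_def algebra_simps)
  then show ?thesis
    by (simp add: case_prod_unfold cong del: if_weak_cong)
qed

lemma sum_mixed_swap: "(\<Sum>(d, e, p, q)\<in>mixed_quads k. f e d p q)
    = (\<Sum>(d, e, p, q)\<in>mixed_quads k. f d e p q)"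
  by (rule sum.reindex_bij_witness[where i = "\<lambda>(d, e, p, q). (e, d, p, q)"
      and j = "\<lambda>(d, e, p, q). (e, d, p, q)"])
    (auto simp: mixed_quads_def mult.commute)

lemma sum_even_swap_left: "(\<Sum>(d, e, p, q)\<in>even_quads k. f e d p q)
    = (\<Sum>(d, e, p, q)\<in>even_quads k. f d e p q)"
  by (rule sum.reindex_bij_witness[where i = "\<lambda>(d, e, p, q). (e, d, p, q)"
      and j = "\<lambda>(d, e, p, q). (e, d, p, q)"])
    (auto simp: even_quads_def mult.commute)

lemma sum_even_swap_right: "(\<Sum>(d, e, p, q)\<in>even_quads k. f d e q p)
    = (\<Sum>(d, e, p, q)\<in>even_quads k. f d e p q)"
  by (rule sum.reindex_bij_witness[where i = "\<lambda>(d, e, p, q). (d, e, q, p)"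
      and j = "\<lambda>(d, e, p, q). (d, e, q, p)"])
    (auto simp: even_quads_def mult.commute)

text \<open>
  The functions \<open>h1\<close>, \<open>h2\<close>, \<open>h3\<close> are a solution, found by computer linear algebra over indicator
  functions of cones, of the requirement that the two flows below, symmetrised over the
  exchanges \<open>d \<leftrightarrow> e\<close> and (for even quadruples) \<open>p \<leftrightarrow> q\<close>, reproduce the counting functions pointwise.
  The totals of the two flows cancel by the three reindexings above. The doubled terms with \<open><\<close> and
  \<open>\<le>\<close> average over the ties that parity does not exclude, so that only the ties \<open>d = q\<close> and \<open>e = q\<close>
  leave a residue.
\<close>

definition h1 :: "int \<Rightarrow> int \<Rightarrow> int \<Rightarrow> int \<Rightarrow> int" where
  "h1 d e p q = 2 * of_bool (q < e \<and> q < d + p) - of_bool (q < e) + of_bool (p + q < e)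
     - 4 * of_bool (p < d + q) + 2"

definition h2 :: "int \<Rightarrow> int \<Rightarrow> int \<Rightarrow> int \<Rightarrow> int" where
  "h2 d e p q = 2 - 2 * of_bool (e < d + q) - of_bool (p < d + q) - of_bool (p \<le> d + q)"

definition h3 :: "int \<Rightarrow> int \<Rightarrow> int \<Rightarrow> int \<Rightarrow> int" where
  "h3 d e p q = of_bool (p < e + q \<and> e + q < d) + of_bool (p \<le> e + q \<and> e + q < d)
     - 4 * of_bool (e < d + q) - 2 * of_bool (q < e) - 2 * of_bool (e + q < d)"

definition mixed_flow :: "int \<Rightarrow> int \<Rightarrow> int \<Rightarrow> int \<Rightarrow> int" where
  "mixed_flow d e p q =
     (if d < q then h1 d (e + p) p (q - d) else 0) - (if p < e then h2 d e p q else 0)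
     + (if d < p then h3 (p - d) q (e + q) d else 0) - (if e < p then h3 d e p q else 0)"

definition even_flow :: "int \<Rightarrow> int \<Rightarrow> int \<Rightarrow> int \<Rightarrow> int" where
  "even_flow d e p q =
     (if d < q then h2 d (e + p) p (q - d) else 0) - (if p < e then h1 d e p q else 0)"

text \<open>The first indicator describes the solutions of
  \<open>w^2 + a b + b c + c a = 4 k\<close> with \<open>c < w\<close>, the second those with
  \<open>w < c\<close> and \<open>(c - w) div 2\<close> even. The inequalities say that the linear
  forms giving \<open>w\<close>, \<open>a\<close>, \<open>b\<close> are positive.\<close>

definition mixed_count :: "int \<Rightarrow> int \<Rightarrow> int \<Rightarrow> int \<Rightarrow> int" where
  "mixed_count d e p q =
     of_bool (q < p + 2 * d \<and> p < q + 2 * d \<and> q < p + 2 * e \<and> p < q + 2 * e)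
     + of_bool (d < e + q \<and> e < d + q \<and> q < d + e)"

text \<open>This describes the remaining solutions, with \<open>w < c\<close> and
  \<open>(c - w) div 2\<close> odd.\<close>

definition even_count :: "int \<Rightarrow> int \<Rightarrow> int \<Rightarrow> int \<Rightarrow> int" where
  "even_count d e p q = of_bool (\<bar>p - q\<bar> < e \<and> e < p + q)"

text \<open>Once the order of the compared linear forms is fixed, every indicator is constant, so
  finitely many cases remain. The forms in each alternative have opposite parity on even quadruples,
  so no ties occur there. The sum over both exchanges is symmetric, which allows
  \<open>d \<le> e\<close> and \<open>p \<le> q\<close>.\<close>

lemma even_flow_ordered:
  assumes "0 < d" "0 < e" "0 < p" "0 < q" "d \<le> e" "p \<le> q"
    and "p < d \<or> d < p" "p < e \<or> e < p" "q < d \<or> d < q" "q < e \<or> e < q"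
      "p + q < d \<or> d < p + q" "p + q < e \<or> e < p + q" "d + p < q \<or> q < d + p"
          "e + p < q \<or> q < e + p"
  shows "even_count d e p q + even_count e d p q + even_count d e q p + even_count e d q p
      = even_flow d e p q + even_flow e d p q + even_flow d e q p + even_flow e d q p"
  using assms(7-14)
  apply (elim disjE)
  apply (use assms(1-6) in \<open>linarith | (simp add: even_count_def even_flow_def h1_def h2_def;
      fail)\<close>)+
  done

lemma mixed_flow_ordered:
  assumes pos: "0 < d" "0 < e" "0 < p" "0 < q" "d \<le> e"
    and 1: "p < d \<or> d < p \<and> p < e \<or> e < p"
    and 2: "p < q \<or> q < p"
    and 3: "q < d \<or> q = d \<or> d < q" "q < e \<or> q = e \<or> e < q"
    and 4: "q < d + e \<or> d + e < q" "e < d + q \<or> d + q < e"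
    and 5: "q < p + 2 * d \<or> p + 2 * d < q" "p < q + 2 * d \<or> q + 2 * d < p"
    and 6: "q < d + e + p \<or> d + e + p < q"  "q < p + 2 * e \<or> p + 2 * e < q"
        "p < q + 2 * e \<or> q + 2 * e < p"
  shows "2 * mixed_count d e p q = mixed_flow d e p q + mixed_flow e d p q
      + 2 * of_bool (e = q \<and> q < p) + 2 * of_bool (d = q \<and> q < p)"
  unfolding mixed_count_def mixed_flow_def h1_def h2_def h3_def
  \<comment> \<open>discarding contradictory cases after each round keeps their number small\<close>
  apply (insert pos 1 2,
      (elim disjE conjE;
       ((rule FalseE; linarith)?; insert 3; elim disjE;
        ((rule FalseE; linarith)?; insert 4; elim disjE;
         ((rule FalseE; linarith)?; insert 5; elim disjE;
          ((rule FalseE; linarith)?; insert 6; elim disjE;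
           ((rule FalseE; linarith) | simp)))))))
  done

lemma even_count_eq_flow:
  assumes "(d, e, p, q) \<in> even_quads k"
  shows "even_count d e p q + even_count e d p q + even_count d e q p + even_count e d q p
      = even_flow d e p q + even_flow e d p q + even_flow d e q p + even_flow e d q p"
proof -
  have pos: "0 < d" "0 < e" "0 < p" "0 < q" and par: "odd d" "odd e" "even p" "even q"
    using assms by (auto simp: even_quads_def)
  have *: "x < y \<or> y < x" if "odd x \<noteq> odd y" for x y :: int
    using that by (metis linorder_neqE)
  consider "d \<le> e" "p \<le> q" | "e \<le> d" "p \<le> q" | "d \<le> e" "q \<le> p" | "e \<le> d" "q \<le> p"
    by linarith
  then show ?thesis
  proof cases
    case 1
    show ?thesis
      by (rule even_flow_ordered) (use 1 pos par in \<open>auto intro!: *\<close>)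
  next
    case 2
    have "even_count e d p q + even_count d e p q + even_count e d q p + even_count d e q p
        = even_flow e d p q + even_flow d e p q + even_flow e d q p + even_flow d e q p"
      by (rule even_flow_ordered) (use 2 pos par in \<open>auto intro!: *\<close>)
    then show ?thesis by simp
  next
    case 3
    have "even_count d e q p + even_count e d q p + even_count d e p q + even_count e d p q
        = even_flow d e q p + even_flow e d q p + even_flow d e p q + even_flow e d p q"
      by (rule even_flow_ordered) (use 3 pos par in \<open>auto intro!: *\<close>)
    then show ?thesis by simp
  next
    case 4
    have "even_count e d q p + even_count d e q p + even_count e d p q + even_count d e p q
        = even_flow e d q p + even_flow d e q p + even_flow e d p q + even_flow d e p q"
      by (rule even_flow_ordered) (use 4 pos par in \<open>auto intro!: *\<close>)
    then show ?thesis by simp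
  qed
qed

lemma mixed_count_swap: "mixed_count e d p q = mixed_count d e p q"
  by (auto simp: mixed_count_def)

lemma mixed_count_eq_flow:
  assumes "(d, e, p, q) \<in> mixed_quads k"
  shows "2 * mixed_count d e p q = mixed_flow d e p q + mixed_flow e d p q
      + 2 * of_bool (e = q \<and> q < p) + 2 * of_bool (d = q \<and> q < p)"
proof -
  have *: "2 * mixed_count d e p q = mixed_flow d e p q + mixed_flow e d p q
      + 2 * of_bool (e = q \<and> q < p) + 2 * of_bool (d = q \<and> q < p)"
    if "d \<le> e" "(d, e, p, q) \<in> mixed_quads k" for d e p q
  proof -
    have pos: "0 < d" "0 < e" "0 < p" "0 < q" and par: "odd d" "odd e" "even p" "odd q"
      using that by (auto simp: mixed_quads_def)
    have *: "x < y \<or> y < x" if "odd x \<noteq> odd y" for x y :: int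
      using that by (metis linorder_neqE)
    have **: "p < d \<or> d < p \<and> p < e \<or> e < p"
      using *[of p d] *[of p e] par by auto
    show ?thesis
      by (rule mixed_flow_ordered) (use that pos par in \<open>auto intro!: * **\<close>)
  qed
  show ?thesis
  proof (cases "d \<le> e")
    case True
    then show ?thesis using assms by (intro *)
  next
    case False
    then have "2 * mixed_count e d p q = mixed_flow e d p q + mixed_flow d e p q
        + 2 * of_bool (d = q \<and> q < p) + 2 * of_bool (e = q \<and> q < p)"
      using assms by (intro *) (auto simp: mixed_quads_def mult.commute)
    then show ?thesis by (simp add: mixed_count_swap)
  qed
qed

lemma sum_flow: "(\<Sum>(d, e, p, q)\<in>mixed_quads k. mixed_flow d e p q)
    + (\<Sum>(d, e, p, q)\<in>even_quads k. even_flow d e p q) = 0"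
proof -
  have "(\<Sum>(d, e, p, q)\<in>mixed_quads k. if d < q then h1 d (e + p) p (q - d) else 0)
      = (\<Sum>(d, e, p, q)\<in>even_quads k. if p < e then h1 d e p q else 0)"
    by (rule sum_mixed_to_even)
  moreover have "(\<Sum>(d, e, p, q)\<in>even_quads k. if d < q then h2 d (e + p) p (q - d) else 0)
      = (\<Sum>(d, e, p, q)\<in>mixed_quads k. if p < e then h2 d e p q else 0)"
    by (rule sum_even_to_mixed)
  moreover have "(\<Sum>(d, e, p, q)\<in>mixed_quads k. if d < p then h3 (p - d) q (e + q) d else 0)
      = (\<Sum>(d, e, p, q)\<in>mixed_quads k. if e < p then h3 d e p q else 0)"
    by (rule sum_mixed_to_mixed)
  ultimately show ?thesis
    by (simp add: mixed_flow_def even_flow_def case_prod_unfold sum.distrib sum_subtractf)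
qed

text \<open>On summing the pointwise identities the exchanges leave each sum unchanged and the flows
  cancel. Only the corrections survive, and those for \<open>e = q\<close> and \<open>d = q\<close>
  have equal totals.\<close>

lemma sum_count: "(\<Sum>(d, e, p, q)\<in>mixed_quads k. mixed_count d e p q)
    + (\<Sum>(d, e, p, q)\<in>even_quads k. even_count d e p q)
    = 2 * int (card {(d, e, p, q) \<in> mixed_quads k. d = q \<and> q < p})"
proof -
  have "2 * (\<Sum>(d, e, p, q)\<in>mixed_quads k. mixed_count d e p q)
      = (\<Sum>(d, e, p, q)\<in>mixed_quads k. mixed_flow d e p q + mixed_flow e d p q
          + 2 * of_bool (e = q \<and> q < p) + 2 * of_bool (d = q \<and> q < p))"
    unfolding sum_distrib_left by (rule sum.cong) (auto simp: mixed_count_eq_flow)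
  also have "\<dots> = 2 * (\<Sum>(d, e, p, q)\<in>mixed_quads k. mixed_flow d e p q)
      + 4 * (\<Sum>(d, e, p, q)\<in>mixed_quads k. of_bool (d = q \<and> q < p))"
    using sum_mixed_swap[of mixed_flow k] sum_mixed_swap[of "\<lambda>d e p q. of_bool (d = q \<and> q < p)" k]
    by (simp add: case_prod_unfold sum.distrib flip: sum_distrib_left)
  finally have 1: "(\<Sum>(d, e, p, q)\<in>mixed_quads k. mixed_count d e p q)
      = (\<Sum>(d, e, p, q)\<in>mixed_quads k. mixed_flow d e p q)
          + 2 * (\<Sum>(d, e, p, q)\<in>mixed_quads k. of_bool (d = q \<and> q < p))"
    by simp
  have sym: "(\<Sum>(d, e, p, q)\<in>even_quads k. f d e p q + f e d p q + f d e q p + f e d q p)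
      = 4 * (\<Sum>(d, e, p, q)\<in>even_quads k. f d e p q)"
    for f :: "int \<Rightarrow> int \<Rightarrow> int \<Rightarrow> int \<Rightarrow> int"
    using sum_even_swap_left[of f k] sum_even_swap_right[of f k] sum_even_swap_right[of "\<lambda>d e p q.
        f e d p q" k]
    by (simp add: case_prod_unfold sum.distrib)
  have "(\<Sum>(d, e, p, q)\<in>even_quads k. even_count d e p q)
      = (\<Sum>(d, e, p, q)\<in>even_quads k. even_flow d e p q)"
    using sym[of even_count] sym[of even_flow] sum.cong[OF refl, of "even_quads k"
        "\<lambda>(d, e, p, q). even_count d e p q + even_count e d p q + even_count d e q p
        + even_count e d q p"
      "\<lambda>(d, e, p, q). even_flow d e p q + even_flow e d p q + even_flow d e q p
          + even_flow e d q p"] even_count_eq_flow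
    by (auto simp: case_prod_unfold)
  moreover have "(\<Sum>(d, e, p, q)\<in>mixed_quads k. of_bool (d = q \<and> q < p))
      = int (card {(d, e, p, q) \<in> mixed_quads k. d = q \<and> q < p})"
    using finite_mixed_quads[of k] by (simp add: case_prod_unfold of_bool_def
        sum.inter_filter[symmetric])
  ultimately show ?thesis
    using 1 sum_flow[of k] by simp
qed

subsection \<open>Solutions of \<open>w\<^sup>2 + a b + b c + c a = 4 k\<close>\<close>

definition square_tri :: "int \<Rightarrow> (int \<times> int \<times> int \<times> int) set" where
  "square_tri m = {(w, a, b, c). 0 < w \<and> 0 < a \<and> 0 < b \<and> 0 < c \<and> odd w \<and> odd a \<and> odd b \<and> odd c
      \<and> w\<^sup>2 + (a * b + b * c + c * a) = m}"

definition factor_pairs :: "int \<Rightarrow> (int \<times> int) set" where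
  "factor_pairs n = {(d, e). 0 < d \<and> 0 < e \<and> d * e = n}"

lemma finite_factor_pairs: "finite (factor_pairs n)"
proof (rule finite_subset)
  show "factor_pairs n \<subseteq> {0..n} \<times> {0..n}"
    by (auto simp: factor_pairs_def)
qed simp

lemma sum_factor_pairs_swap: "(\<Sum>(d, e)\<in>factor_pairs n. f e d) = (\<Sum>(d, e)\<in>factor_pairs n. f d e)"
  by (rule sum.reindex_bij_witness[where i = "\<lambda>(d, e). (e, d)" and j = "\<lambda>(d, e). (e, d)"])
    (auto simp: factor_pairs_def mult.commute)

lemma card_odd_below: "0 \<le> m \<Longrightarrow> int (card {c. 0 < c \<and> odd c \<and> c < 2 * m}) = m" for m :: int
proof -
  assume "0 \<le> m"
  have "{c. 0 < c \<and> odd c \<and> c < 2 * m} = (\<lambda>i. 2 * i + 1) ` {0..<m}"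
    by (auto simp: image_iff elim!: oddE)
  moreover have "card ((\<lambda>i. 2 * i + 1) ` {0..<m}) = card {0..<m}"
    by (rule card_image) (auto simp: inj_on_def)
  ultimately show ?thesis
    using \<open>0 \<le> m\<close> by simp
qed

lemma card_even_between:
  fixes d e :: int
  assumes "odd d" "odd e"
  shows "2 * int (card {p. even p \<and> d < p \<and> p < e}) = max 0 (e - d)"
proof -
  obtain x y where xy: "d = 2 * x + 1" "e = 2 * y + 1"
    using assms by (auto elim!: oddE)
  have "{p. even p \<and> d < p \<and> p < e} = (\<lambda>i. 2 * i) ` {x<..y}"
    by (auto simp: image_iff xy elim!: evenE)
  moreover have "card ((\<lambda>i. 2 * i) ` {x<..y}) = card {x<..y}"
    by (rule card_image) (auto simp: inj_on_def)
  ultimately show ?thesis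
    by (auto simp: xy)
qed

text \<open>For \<open>d = q\<close> the equation becomes \<open>d * (e + p) = k\<close>. So the
  solutions are factor pairs of \<open>k\<close> together with an even \<open>p\<close> strictly
  between the two odd factors.\<close>

lemma card_mixed_diagonal:
  assumes "odd k"
  shows "2 * int (card {(d, e, p, q) \<in> mixed_quads k. d = q \<and> q < p})
      = (\<Sum>(d, e)\<in>factor_pairs k. max 0 (e - d))"
proof -
  have "bij_betw (\<lambda>((d, e), p). (d, e - p, p, d)) (Sigma (factor_pairs k) (\<lambda>(d, e). {p. even p
      \<and> d < p \<and> p < e})) {(d, e, p, q) \<in> mixed_quads k. d = q \<and> q < p}"
    by (rule bij_betw_byWitness[where f' = "\<lambda>(d, e, p, q). ((d, e + p), p)"])
      (use assms in \<open>auto simp: mixed_quads_def factor_pairs_def algebra_simps\<close>)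
  then have "card {(d, e, p, q) \<in> mixed_quads k. d = q \<and> q < p}
      = card (Sigma (factor_pairs k) (\<lambda>(d, e). {p. even p \<and> d < p \<and> p < e}))"
    by (simp add: bij_betw_same_card)
  also have "\<dots> = (\<Sum>(d, e)\<in>factor_pairs k. card {p. even p \<and> d < p \<and> p < e})"
    using finite_factor_pairs by (subst card_SigmaI) (auto simp: case_prod_unfold intro:
        finite_subset[of _ "{_<..<_}"])
  finally have "2 * int (card {(d, e, p, q) \<in> mixed_quads k. d = q \<and> q < p})
      = (\<Sum>(d, e)\<in>factor_pairs k. 2 * int (card {p. even p \<and> d < p \<and> p < e}))"
    by (simp add: case_prod_unfold sum_distrib_left)
  also have "\<dots> = (\<Sum>(d, e)\<in>factor_pairs k. max 0 (e - d))"
    using assms by (intro sum.cong) (auto simp: factor_pairs_def card_even_between)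
  finally show ?thesis .
qed

text \<open>For \<open>w = c\<close> the left side factors as \<open>(a + c) * (b + c)\<close>, with
  both factors even. Each factor pair \<open>(d, e)\<close> of \<open>k\<close> then leaves the odd
  \<open>c\<close> below \<open>2 * min d e\<close>, and there are \<open>min d e\<close> of
  them.\<close>

lemma card_square_tri_eq:
  assumes "odd k"
  shows "int (card {(w, a, b, c) \<in> square_tri (4 * k). w = c}) = (\<Sum>(d, e)\<in>factor_pairs k. min d e)"
proof -
  have "bij_betw (\<lambda>((d, e), c). (c, 2 * d - c, 2 * e - c, c)) (Sigma (factor_pairs k) (\<lambda>(d, e).
      {c. 0 < c \<and> odd c \<and> c < 2 * min d e}))
      {(w, a, b, c) \<in> square_tri (4 * k). w = c}" (is "bij_betw ?f ?S ?T")
  proof (rule bij_betw_imageI)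
    show "inj_on ?f ?S"
      by (auto simp: inj_on_def)
    show "?f ` ?S = ?T"
    proof
      show "?f ` ?S \<subseteq> ?T"
        by (auto simp: square_tri_def factor_pairs_def algebra_simps power2_eq_square)
      show "?T \<subseteq> ?f ` ?S"
      proof (clarify)
        fix w a b c assume "(c, a, b, c) \<in> square_tri (4 * k)"
        then have pos: "0 < a" "0 < b" "0 < c" "odd a" "odd b" "odd c"
            and eq: "c\<^sup>2 + (a * b + b * c + c * a) = 4 * k"
          by (auto simp: square_tri_def)
        then obtain d e where de: "a + c = 2 * d" "b + c = 2 * e"
          by (metis evenE odd_even_add)
        then have ab: "a = 2 * d - c" "b = 2 * e - c"
          by auto
        have "d * e = k"
          using eq unfolding ab by (simp add: algebra_simps power2_eq_square)
        then have "((d, e), c) \<in> ?S"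
          using pos de by (auto simp: factor_pairs_def)
        then show "(c, a, b, c) \<in> ?f ` ?S"
          by (rule rev_image_eqI) (simp add: ab)
      qed
    qed
  qed
  then have "card {(w, a, b, c) \<in> square_tri (4 * k). w = c}
      = card (Sigma (factor_pairs k) (\<lambda>(d, e). {c. 0 < c \<and> odd c \<and> c < 2 * min d e}))"
    by (simp add: bij_betw_same_card)
  also have "\<dots> = (\<Sum>(d, e)\<in>factor_pairs k. card {c. 0 < c \<and> odd c \<and> c < 2 * min d e})"
    using finite_factor_pairs by (subst card_SigmaI) (auto simp: case_prod_unfold intro:
        finite_subset[of _ "{_<..<_}"])
  finally have "int (card {(w, a, b, c) \<in> square_tri (4 * k). w = c})
      = (\<Sum>(d, e)\<in>factor_pairs k. int (card {c. 0 < c \<and> odd c \<and> c < 2 * min d e}))"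
    by (simp add: case_prod_unfold)
  also have "\<dots> = (\<Sum>(d, e)\<in>factor_pairs k. min d e)"
    by (intro sum.cong refl) (clarsimp simp: factor_pairs_def card_odd_below)
  finally show ?thesis .
qed

text \<open>The form equals \<open>(a + c) * (b + c) + (w - c) * (w + c)\<close>. The halves of
  \<open>w - c\<close> and \<open>w + c\<close> add up to the odd number \<open>w\<close>, so
  exactly one of them is even and is called \<open>p\<close>. Hence \<open>c\<close> is the absolute
  difference of \<open>p\<close> and \<open>q\<close>, and the map is injective.\<close>

lemma card_square_tri_gt:
  assumes "odd k"
  shows "card {(w, a, b, c) \<in> square_tri (4 * k). c < w}
    = card {(d, e, p, q) \<in> mixed_quads k. q < p + 2 * d \<and> p < q + 2 * d \<and> q < p + 2 * e \<and> p < q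
        + 2 * e}" (is "card ?T = card ?S")
proof -
  let ?f = "\<lambda>(d, e, p, q). (p + q, 2 * d - \<bar>q - p\<bar>, 2 * e - \<bar>q - p\<bar>, \<bar>q - p\<bar>)"
  have "bij_betw ?f ?S ?T"
  proof (rule bij_betw_imageI)
    show "inj_on ?f ?S"
    proof (rule inj_onI)
      fix x y assume xy: "x \<in> ?S" "y \<in> ?S" "?f x = ?f y"
      obtain d e p q d' e' p' q' where eqs: "x = (d, e, p, q)" "y = (d', e', p', q')"
        by (cases x, cases y)
      have "p = p' \<and> q = q' \<or> p = q' \<and> q = p'"
        using xy(3) unfolding eqs prod.case prod.inject by linarith
      then show "x = y"
        using xy unfolding eqs by (auto simp: mixed_quads_def)
    qed
    show "?f ` ?S = ?T"
    proof
      have "(p + q)\<^sup>2 + ((2 * d - \<bar>q - p\<bar>) * (2 * e - \<bar>q - p\<bar>) + (2 * e - \<bar>q - p\<bar>) * \<bar>q - p\<bar>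
          + \<bar>q - p\<bar> * (2 * d - \<bar>q - p\<bar>)) = 4 * (d * e + p * q)"
        for d e p q :: int
        by (cases "p \<le> q") (simp_all add: algebra_simps power2_eq_square)
      then show "?f ` ?S \<subseteq> ?T"
        by (auto simp: square_tri_def mixed_quads_def)
      show "?T \<subseteq> ?f ` ?S"
      proof (clarify)
        fix w a b c assume "(w, a, b, c) \<in> square_tri (4 * k)" and "c < w"
        then have pos: "0 < a" "0 < b" "0 < c" "odd a" "odd b" "odd c" "odd w" "c < w"
            and eq: "w\<^sup>2 + (a * b + b * c + c * a) = 4 * k"
          by (auto simp: square_tri_def)
        obtain d e p where de: "a + c = 2 * d" "b + c = 2 * e" "w - c = 2 * p"
          using pos by (metis evenE odd_even_add even_diff)
        then have ab: "a = 2 * d - c" "b = 2 * e - c" "w = 2 * p + c"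
          by auto
        have k: "d * e + p * (p + c) = k"
          using eq unfolding ab by (simp add: algebra_simps power2_eq_square)
        have "even (p * (p + c))"
          using pos by simp
        then have "odd (d * e)"
          using k assms by (metis even_add)
        then have par: "odd d" "odd e"
          by auto
        show "(w, a, b, c) \<in> ?f ` ?S"
        proof (cases "even p")
          case True
          then have "(d, e, p, p + c) \<in> ?S"
            using pos de par k by (auto simp: mixed_quads_def)
          then show ?thesis
            by (rule rev_image_eqI) (use pos in \<open>simp add: ab\<close>)
        next
          case False
          then have "(d, e, p + c, p) \<in> ?S"
            using pos de par k by (auto simp: mixed_quads_def mult.commute)
          then show ?thesis
            by (rule rev_image_eqI) (use pos in \<open>simp add: ab\<close>)
        qed
      qed
    qed
  qed
  then show ?thesis
    by (simp add: bij_betw_same_card)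
qed

text \<open>With \<open>a + w = 2 * d\<close>, \<open>b + w = 2 * e\<close> and
  \<open>c - w = 2 * p\<close> the form becomes \<open>4 * (d * e + p * (d + e - w))\<close>, so
  \<open>q = d + e - w\<close>. For even \<open>p\<close> both \<open>d\<close> and \<open>e\<close>
  must be odd.\<close>

lemma card_square_tri_lt_even:
  assumes "odd k"
  shows "card {(w, a, b, c) \<in> square_tri (4 * k). w < c \<and> even ((c - w) div 2)}
    = card {(d, e, p, q) \<in> mixed_quads k. d < e + q \<and> e < d + q \<and> q < d + e}" (is "card ?T
        = card ?S")
proof -
  let ?f = "\<lambda>(d, e, p, q). (d + e - q, d - e + q, e - d + q, d + e - q + 2 * p)"
  have "bij_betw ?f ?S ?T"
  proof (rule bij_betw_imageI)
    show "inj_on ?f ?S"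
      by (auto simp: inj_on_def)
    show "?f ` ?S = ?T"
    proof
      show "?f ` ?S \<subseteq> ?T"
        by (auto simp: square_tri_def mixed_quads_def algebra_simps power2_eq_square)
      show "?T \<subseteq> ?f ` ?S"
      proof (clarify)
        fix w a b c assume "(w, a, b, c) \<in> square_tri (4 * k)" and "w < c"
            and ev: "even ((c - w) div 2)"
        then have pos: "0 < w" "0 < a" "0 < b" "0 < c" "odd a" "odd b" "odd c" "odd w" "w < c"
            and eq: "w\<^sup>2 + (a * b + b * c + c * a) = 4 * k"
          by (auto simp: square_tri_def)
        obtain d e p where de: "a + w = 2 * d" "b + w = 2 * e" "c - w = 2 * p"
          using pos by (metis evenE odd_even_add even_diff)
        then have ab: "a = 2 * d - w" "b = 2 * e - w" "c = 2 * p + w"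
          by auto
        have k: "d * e + p * (d + e - w) = k"
          using eq unfolding ab by (simp add: algebra_simps power2_eq_square)
        have "even p"
          using ev de by simp
        then have "odd (d * e)"
          using k assms by (metis even_add even_mult_iff)
        then have "odd d" "odd e"
          by auto
        then have "(d, e, p, d + e - w) \<in> ?S"
          using pos de k \<open>even p\<close> by (auto simp: mixed_quads_def)
        then show "(w, a, b, c) \<in> ?f ` ?S"
          by (rule rev_image_eqI) (simp add: ab)
      qed
    qed
  qed
  then show ?thesis
    by (simp add: bij_betw_same_card)
qed

text \<open>This is the substitution of the even case, but for odd \<open>p\<close> it is
  \<open>d\<close> and \<open>e\<close> that are even. The two products therefore change places in
  the quadruple.\<close>

lemma card_square_tri_lt_odd:
  assumes "odd k"
  shows "card {(w, a, b, c) \<in> square_tri (4 * k). w < c \<and> odd ((c - w) div 2)}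
    = card {(d, e, p, q) \<in> even_quads k. \<bar>p - q\<bar> < e \<and> e < p + q}" (is "card ?T = card ?S")
proof -
  let ?f = "\<lambda>(d, e, p, q). (p + q - e, p - q + e, q - p + e, p + q - e + 2 * d)"
  have "bij_betw ?f ?S ?T"
  proof (rule bij_betw_imageI)
    show "inj_on ?f ?S"
      by (auto simp: inj_on_def)
    show "?f ` ?S = ?T"
    proof
      show "?f ` ?S \<subseteq> ?T"
        by (auto simp: square_tri_def even_quads_def algebra_simps power2_eq_square)
      show "?T \<subseteq> ?f ` ?S"
      proof (clarify)
        fix w a b c assume "(w, a, b, c) \<in> square_tri (4 * k)" and "w < c"
            and ev: "odd ((c - w) div 2)"
        then have pos: "0 < w" "0 < a" "0 < b" "0 < c" "odd a" "odd b" "odd c" "odd w" "w < c"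
            and eq: "w\<^sup>2 + (a * b + b * c + c * a) = 4 * k"
          by (auto simp: square_tri_def)
        obtain d e p where de: "a + w = 2 * d" "b + w = 2 * e" "c - w = 2 * p"
          using pos by (metis evenE odd_even_add even_diff)
        then have ab: "a = 2 * d - w" "b = 2 * e - w" "c = 2 * p + w"
          by auto
        have k: "d * e + p * (d + e - w) = k"
          using eq unfolding ab by (simp add: algebra_simps power2_eq_square)
        have "odd p"
          using ev de by simp
        \<comment> \<open>Since \<open>p\<close> and \<open>w\<close> are odd, the expression is
          congruent to \<open>(d + 1) * (e + 1)\<close> modulo 2.\<close>
        have "even d \<and> even e"
        proof -
          have "odd (d * e + p * (d + e - w))"
            using k assms by simp
          then show ?thesis
            using \<open>odd p\<close> pos by auto
        qed
        then have "(p, d + e - w, d, e) \<in> ?S"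
          using pos de k \<open>odd p\<close> by (auto simp: even_quads_def)
        then show "(w, a, b, c) \<in> ?f ` ?S"
          by (rule rev_image_eqI) (simp add: ab)
      qed
    qed
  qed
  then show ?thesis
    by (simp add: bij_betw_same_card)
qed

lemma finite_square_tri: "finite (square_tri m)"
proof (rule finite_subset)
  show "square_tri m \<subseteq> {0..m} \<times> {0..m} \<times> {0..m} \<times> {0..m}"
  proof
    fix x assume "x \<in> square_tri m"
    then obtain w a b c where x: "x = (w, a, b, c)" and pos: "0 < w" "0 < a" "0 < b" "0 < c"
        and eq: "w\<^sup>2 + (a * b + b * c + c * a) = m"
      by (auto simp: square_tri_def)
    have "w * 1 \<le> w * w" "a * 1 \<le> a * b" "1 * b \<le> a * b" "1 * c \<le> b * c"
      using pos by (intro mult_mono; simp)+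
    moreover have "0 < c * a" "0 < a * b" "0 < b * c" "0 < w * w"
      using pos by simp_all
    ultimately have "w \<le> m" "a \<le> m" "b \<le> m" "c \<le> m"
      using eq unfolding power2_eq_square by linarith+
    then show "x \<in> {0..m} \<times> {0..m} \<times> {0..m} \<times> {0..m}"
      using pos x by simp
  qed
qed simp

text \<open>Solutions with \<open>w = c\<close> contribute \<open>min d e\<close> for each factor
  pair, and all others together contribute the tie residue \<open>max 0 (e - d)\<close>. These add
  up to \<open>e\<close>.\<close>

lemma card_square_tri:
  assumes "odd k"
  shows "int (card (square_tri (4 * k))) = (\<Sum>(d, e)\<in>factor_pairs k. d)"
proof -
  let ?T1 = "{(w, a, b, c) \<in> square_tri (4 * k). w = c}"
  let ?T2 = "{(w, a, b, c) \<in> square_tri (4 * k). c < w}"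
  let ?T3 = "{(w, a, b, c) \<in> square_tri (4 * k). w < c \<and> even ((c - w) div 2)}"
  let ?T4 = "{(w, a, b, c) \<in> square_tri (4 * k). w < c \<and> odd ((c - w) div 2)}"
  have "int (card (square_tri (4 * k))) = (\<Sum>(w, a, b, c)\<in>square_tri (4 * k). of_bool (w
      = c) + of_bool (c < w)
      + of_bool (w < c \<and> even ((c - w) div 2)) + of_bool (w < c \<and> odd ((c - w) div 2)))"
    unfolding card_eq_sum of_nat_sum by (rule sum.cong) auto
  also have "\<dots> = int (card ?T1) + int (card ?T2) + int (card ?T3) + int (card ?T4)"
    using finite_square_tri[of "4 * k"]
    by (simp add: case_prod_unfold sum.distrib of_bool_def sum.inter_filter[symmetric])
  finally have "int (card (square_tri (4 * k)))
      = (\<Sum>(d, e)\<in>factor_pairs k. min d e) + (int (card ?T2) + int (card ?T3)) + int (card ?T4)"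
    by (simp add: card_square_tri_eq[OF assms])
  also have "int (card ?T2) + int (card ?T3) = (\<Sum>(d, e, p, q)\<in>mixed_quads k. mixed_count d e p q)"
    unfolding card_square_tri_gt[OF assms] card_square_tri_lt_even[OF assms]
    using finite_mixed_quads[of k] by (simp add: mixed_count_def case_prod_unfold sum.distrib
        of_bool_def sum.inter_filter[symmetric])
  also have "int (card ?T4) = (\<Sum>(d, e, p, q)\<in>even_quads k. even_count d e p q)"
    unfolding card_square_tri_lt_odd[OF assms]
    using finite_even_quads[of k] by (simp add: even_count_def case_prod_unfold of_bool_def
        sum.inter_filter[symmetric])
  finally have "int (card (square_tri (4 * k)))
      = (\<Sum>(d, e)\<in>factor_pairs k. min d e) + 2 * int (card {(d, e, p, q) \<in> mixed_quads k. d
      = q \<and> q < p})"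
    using sum_count[of k] by linarith
  also have "\<dots> = (\<Sum>(d, e)\<in>factor_pairs k. min d e + max 0 (e - d))"
    unfolding card_mixed_diagonal[OF assms] by (simp add: case_prod_unfold sum.distrib)
  also have "\<dots> = (\<Sum>(d, e)\<in>factor_pairs k. e)"
    by (rule sum.cong) auto
  also have "\<dots> = (\<Sum>(d, e)\<in>factor_pairs k. d)"
    by (rule sum_factor_pairs_swap)
  finally show ?thesis .
qed

subsection \<open>Sums of odd squares\<close>

lemma odd_square_mod_8:
  fixes w :: int
  assumes "odd w"
  shows "w\<^sup>2 mod 8 = 1"
proof -
  obtain x where x: "w = 2 * x + 1"
    using assms by (elim oddE)
  have "even (x * (x + 1))"
    by simp
  then obtain y where "x * (x + 1) = 2 * y"
    by (elim evenE)
  then have "w\<^sup>2 = 8 * y + 1"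
    by (simp add: x power2_eq_square algebra_simps)
  then show ?thesis
    by simp
qed

definition odd_roots :: "int \<Rightarrow> int set" where
  "odd_roots m = {w. 0 < w \<and> odd w \<and> w\<^sup>2 < m}"

lemma le_square: "w \<le> w\<^sup>2" for w :: int
proof (cases "1 \<le> w")
  case True
  then show ?thesis
    by (simp add: self_le_power)
next
  case False
  then show ?thesis
    using zero_le_power2[of w] by linarith
qed

lemma finite_odd_roots: "finite (odd_roots m)"
proof (rule finite_subset)
  show "odd_roots m \<subseteq> {0..m}"
    using le_square by (force simp: odd_roots_def intro: order_trans)
qed simp

text \<open>The term for \<open>w = 1\<close> is \<open>c m 1 * F m\<close>. All other arguments are
  smaller, positive, and congruent to \<open>m\<close> modulo 8 because odd squares are 1 modulo 8.
  Induction thus applies unless the leading coefficient vanishes, which is left to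
  \<open>base\<close>.\<close>

lemma square_recursion_zero:
  fixes F :: "int \<Rightarrow> int" and c :: "int \<Rightarrow> int \<Rightarrow> int"
  assumes rec: "\<And>m. 0 < m \<Longrightarrow> m mod 8 = r \<Longrightarrow> (\<Sum>w\<in>odd_roots (m + 1). c m w * F (m + 1 - w\<^sup>2)) = 0"
    and base: "\<And>m. 0 < m \<Longrightarrow> m mod 8 = r \<Longrightarrow> c m 1 = 0 \<Longrightarrow> F m = 0"
    and "0 < m" "m mod 8 = r"
  shows "F m = 0"
  using assms(3,4)
proof (induction "nat m" arbitrary: m rule: less_induct)
  case less
  have "F (m + 1 - w\<^sup>2) = 0" if "w \<in> odd_roots (m + 1) - {1}" for w
  proof (rule less.hyps)
    have w: "1 < w" "odd w" "w\<^sup>2 < m + 1"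
      using that by (auto simp: odd_roots_def)
    have "1 < w\<^sup>2"
      using w by (simp add: one_less_power)
    then show "nat (m + 1 - w\<^sup>2) < nat m"
      using less.prems by simp
    show "0 < m + 1 - w\<^sup>2"
      using w by simp
    have "(m + 1 - w\<^sup>2) mod 8 = (m + 1 - w\<^sup>2 mod 8) mod 8"
      by (simp add: mod_simps)
    then show "(m + 1 - w\<^sup>2) mod 8 = r"
      using odd_square_mod_8[OF w(2)] less.prems by simp
  qed
  then have "(\<Sum>w\<in>odd_roots (m + 1) - {1}. c m w * F (m + 1 - w\<^sup>2)) = 0"
    by (intro sum.neutral) simp
  moreover have "1 \<in> odd_roots (m + 1)"
    using less.prems by (simp add: odd_roots_def)
  ultimately have "c m 1 * F m = 0"
    using rec[OF less.prems] finite_odd_roots[of "m + 1"] by (simp add: sum.remove)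
  then show ?case
    using base[OF less.prems] by auto
qed

section \<open>Windmills and Liouville's identity for the divisor sum\<close>

definition windmills :: "int \<Rightarrow> (int \<times> int \<times> int) set" where
  "windmills m = {(w, d, e). odd w \<and> 0 < d \<and> 0 < e \<and> odd d \<and> odd e \<and> w\<^sup>2 + 4 * (d * e) = m}"

lemma finite_windmills: "finite (windmills m)"
proof (rule finite_subset)
  show "windmills m \<subseteq> {-m..m} \<times> {0..m} \<times> {0..m}"
  proof
    fix x assume "x \<in> windmills m"
    then obtain w d e where x: "x = (w, d, e)" and pos: "0 < d" "0 < e"
        and eq: "w\<^sup>2 + 4 * (d * e) = m"
      by (auto simp: windmills_def)
    have "d * 1 \<le> d * e" "1 * e \<le> d * e"
      using pos by (intro mult_mono; simp)+
    then have "w \<le> m" "-w \<le> m" "d \<le> m" "e \<le> m"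
      using eq pos le_square[of w] le_square[of "-w"] zero_le_power2[of w]
      unfolding power2_minus by linarith+
    then show "x \<in> {-m..m} \<times> {0..m} \<times> {0..m}"
      using pos x by simp
  qed
qed simp

lemma sum_windmills_neg: "(\<Sum>(w, d, e)\<in>windmills m. f (- w) d e) = (\<Sum>(w, d, e)\<in>windmills m. f w d e)"
  by (rule sum.reindex_bij_witness[where i = "\<lambda>(w, d, e). (- w, d, e)"
      and j = "\<lambda>(w, d, e). (- w, d, e)"])
    (auto simp: windmills_def)

lemma sum_windmills_swap: "(\<Sum>(w, d, e)\<in>windmills m. f w e d) = (\<Sum>(w, d, e)\<in>windmills m. f w d e)"
  by (rule sum.reindex_bij_witness[where i = "\<lambda>(w, d, e). (w, e, d)"
      and j = "\<lambda>(w, d, e). (w, e, d)"])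
    (auto simp: windmills_def mult.commute)

text \<open>
  The substitution \<open>(w, d, e) \<mapsto> (2 e - w, d + w - e, e)\<close> changes the sign of \<open>(e - w) (2 d
      + w)\<^sup>2\<close>, and where it
  leaves the positive range, \<open>(w + 2 d, d, e - d - w)\<close> turns this weight into \<open>(d + e) w\<^sup>2\<close>.
\<close>

lemma sum_windmills: "(\<Sum>(w, d, e)\<in>windmills m. d * (d * e - w\<^sup>2)) = 0"
proof -
  let ?f = "\<lambda>(w, d, e). (e - w) * (2 * d + w)\<^sup>2 :: int" and ?g = "\<lambda>(w, d, e). (d + e) * w\<^sup>2 :: int"
  let ?X = "{(w, d, e) \<in> windmills m. e < d + w}" and ?Y = "{(w, d, e) \<in> windmills m. d + w < e}"
  let ?X' = "{(w, d, e) \<in> windmills m. d < e + w}" and ?Y' = "{(w, d, e) \<in> windmills m. e + w < d}"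
  have split: "sum h (windmills m) = sum h ?X + sum h ?Y"
      "sum h (windmills m) = sum h ?X' + sum h ?Y'"
    for h :: "int \<times> int \<times> int \<Rightarrow> int"
  proof -
    \<comment> \<open>No ties: \<open>d + w\<close> and \<open>e + w\<close> are even, while
      \<open>d\<close> and \<open>e\<close> are odd.\<close>
    have "windmills m = ?X \<union> ?Y" "windmills m = ?X' \<union> ?Y'"
      by (auto simp: windmills_def) (metis even_add linorder_neqE)+
    moreover have fin: "finite ?X" "finite ?Y" "finite ?X'" "finite ?Y'"
      by (rule finite_subset[OF _ finite_windmills[of m]], force)+
    ultimately show "sum h (windmills m) = sum h ?X + sum h ?Y"
        "sum h (windmills m) = sum h ?X' + sum h ?Y'"
      using sum.union_disjoint[OF fin(1,2), of h] sum.union_disjoint[OF fin(3,4), of h]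
      by (auto simp: disjoint_iff)
  qed
  have "sum ?f ?X = (\<Sum>x\<in>?X. - ?f x)"
    by (rule sum.reindex_bij_witness[where i = "\<lambda>(w, d, e). (2 * e - w, d + w - e, e)"
        and j = "\<lambda>(w, d, e). (2 * e - w, d + w - e, e)"])
      (auto simp: windmills_def algebra_simps power2_eq_square)
  then have "sum ?f ?X = 0"
    by (simp add: sum_negf)
  moreover have "sum ?f ?Y = sum ?g ?X'"
    by (rule sum.reindex_bij_witness[where i = "\<lambda>(w, d, e). (w - 2 * d, d, e + w - d)"
        and j = "\<lambda>(w, d, e). (w + 2 * d, d, e - d - w)"])
      (auto simp: windmills_def algebra_simps power2_eq_square)
  moreover have "sum ?g ?X' = sum ?g ?Y'"
    by (rule sum.reindex_bij_witness[where i = "\<lambda>(w, d, e). (- w, e, d)"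
        and j = "\<lambda>(w, d, e). (- w, e, d)"])
      (auto simp: windmills_def algebra_simps power2_eq_square)
  ultimately have 1: "2 * sum ?f (windmills m) = sum ?g (windmills m)"
    using split(1)[of ?f] split(2)[of ?g] by simp
  have 2: "sum ?g (windmills m) = 2 * (\<Sum>(w, d, e)\<in>windmills m. d * w\<^sup>2)"
    using sum_windmills_swap[of "\<lambda>w d e. d * w\<^sup>2" m] by (simp add: case_prod_unfold distrib_right
        sum.distrib)
  \<comment> \<open>Averaging over \<open>w\<close> and \<open>-w\<close> removes the terms odd in
    \<open>w\<close>. What remains is 8 times the desired sum plus the total of
    \<open>2 * e * w^2\<close>, and the latter equals \<open>sum ?g\<close> over all
    windmills.\<close>
  have "2 * sum ?f (windmills m) = (\<Sum>(w, d, e)\<in>windmills m. (e - w) * (2 * d + w)\<^sup>2 + (e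
      + w) * (2 * d - w)\<^sup>2)"
    using sum_windmills_neg[of "\<lambda>w d e. (e - w) * (2 * d
        + w)\<^sup>2" m] by (simp add: case_prod_unfold sum.distrib)
  also have "\<dots> = (\<Sum>(w, d, e)\<in>windmills m. 8 * (d * (d * e - w\<^sup>2)) + 2 * (e * w\<^sup>2))"
    by (rule sum.cong) (auto simp: algebra_simps power2_eq_square)
  also have "\<dots> = 8 * (\<Sum>(w, d, e)\<in>windmills m. d * (d * e - w\<^sup>2))
      + 2 * (\<Sum>(w, d, e)\<in>windmills m. d * w\<^sup>2)"
    using sum_windmills_swap[of "\<lambda>w d e. d * w\<^sup>2" m]
    by (simp add: case_prod_unfold sum.distrib flip: sum_distrib_left)
  finally show ?thesis
    using 1 2 by simp
qed

definition divisor_sum :: "int \<Rightarrow> int" where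
  "divisor_sum n = (\<Sum>(d, e)\<in>factor_pairs n. d)"

text \<open>On windmills \<open>m - 5 * w^2 = 4 * (d * e - w^2)\<close>, so this is half of the
  vanishing windmill sum, taken over \<open>w > 0\<close>. The congruence on \<open>m\<close> makes
  \<open>(m - w^2) div 4\<close> odd, which forces both factors to be odd.\<close>

lemma divisor_sum_recursion:
  assumes "m mod 8 = 5"
  shows "(\<Sum>w\<in>odd_roots m. (m - 5 * w\<^sup>2) * divisor_sum ((m - w\<^sup>2) div 4)) = 0"
proof -
  have div: "4 * ((m - w\<^sup>2) div 4) = m - w\<^sup>2" "odd ((m - w\<^sup>2) div 4)" if "odd w" for w
    using odd_square_mod_8[OF that] assms by presburger+
  let ?P = "{(w, d, e) \<in> windmills m. 0 < w}" and ?N = "{(w, d, e) \<in> windmills m. w < 0}"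
  let ?f = "\<lambda>(w, d, e). (m - 5 * w\<^sup>2) * d"
  have "(\<Sum>w\<in>odd_roots m. (m - 5 * w\<^sup>2) * divisor_sum ((m - w\<^sup>2) div 4))
      = (\<Sum>w\<in>odd_roots m. \<Sum>(d, e)\<in>factor_pairs ((m - w\<^sup>2) div 4). ?f (w, d, e))"
    by (simp add: divisor_sum_def sum_distrib_left case_prod_unfold)
  also have "\<dots> = sum (\<lambda>(w, de). ?f (w, de)) (Sigma (odd_roots m) (\<lambda>w. factor_pairs ((m - w\<^sup>2) div
      4)))"
    using sum.Sigma[OF finite_odd_roots, of m "\<lambda>w. factor_pairs ((m - w\<^sup>2) div 4)"
        "\<lambda>w de. ?f (w, de)"] finite_factor_pairs
    by (simp add: case_prod_unfold)
  also have "Sigma (odd_roots m) (\<lambda>w. factor_pairs ((m - w\<^sup>2) div 4)) = ?P"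
  proof (rule set_eqI)
    fix s :: "int \<times> int \<times> int"
    obtain w d e where s: "s = (w, d, e)"
      by (cases s)
    have "w\<^sup>2 < m \<and> d * e = (m - w\<^sup>2) div 4 \<longleftrightarrow> odd d \<and> odd e \<and> w\<^sup>2 + 4 * (d * e) = m"
      if "odd w" "0 < d" "0 < e"
    proof -
      have pos: "0 < d * e"
        using that by simp
      have iff: "d * e = (m - w\<^sup>2) div 4 \<longleftrightarrow> w\<^sup>2 + 4 * (d * e) = m"
        using div(1)[OF that(1)] by (intro iffI; linarith)
      show ?thesis
      proof (cases "w\<^sup>2 + 4 * (d * e) = m")
        case True
        then have "odd (d * e)"
          using iff div(2)[OF that(1)] by simp
        then show ?thesis
          using True iff pos by auto
      next
        case False
        then show ?thesis
          using iff by simp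
      qed
    qed
    then show "s \<in> Sigma (odd_roots m) (\<lambda>w. factor_pairs ((m - w\<^sup>2) div 4)) \<longleftrightarrow> s \<in> ?P"
      unfolding s odd_roots_def factor_pairs_def windmills_def by blast
  qed
  finally have P: "(\<Sum>w\<in>odd_roots m. (m - 5 * w\<^sup>2) * divisor_sum ((m - w\<^sup>2) div 4)) = sum ?f ?P"
    by (simp add: case_prod_unfold)
  have "sum ?f ?N = sum ?f ?P"
    by (rule sum.reindex_bij_witness[where i = "\<lambda>(w, d, e). (- w, d, e)"
        and j = "\<lambda>(w, d, e). (- w, d, e)"])
      (auto simp: windmills_def)
  moreover have "sum ?f (windmills m) = sum ?f ?P + sum ?f ?N"
  proof -
    have "windmills m = ?P \<union> ?N"
      by (auto simp: windmills_def) (metis even_zero linorder_neqE)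
    moreover have fin: "finite ?P" "finite ?N"
      by (rule finite_subset[OF _ finite_windmills[of m]], force)+
    ultimately show ?thesis
      using sum.union_disjoint[OF fin, of ?f] by (auto simp: disjoint_iff)
  qed
  moreover have "sum ?f (windmills m) = 4 * (\<Sum>(w, d, e)\<in>windmills m. d * (d * e - w\<^sup>2))"
    unfolding sum_distrib_left by (rule sum.cong) (auto simp: windmills_def algebra_simps)
  ultimately show ?thesis
    using P sum_windmills[of m] by simp
qed

section \<open>Jacobi's count of representations by four odd squares\<close>

definition three_squares :: "int \<Rightarrow> (int \<times> int \<times> int) set" where
  "three_squares m = {(x, y, z). 0 < x \<and> 0 < y \<and> 0 < z \<and> odd x \<and> odd y \<and> odd z \<and> x\<^sup>2 + y\<^sup>2 + z\<^sup>2
      = m}"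

definition four_squares :: "int \<Rightarrow> (int \<times> int \<times> int \<times> int) set" where
  "four_squares m = Sigma (odd_roots m) (\<lambda>w. three_squares (m - w\<^sup>2))"

definition five_squares :: "int \<Rightarrow> (int \<times> int \<times> int \<times> int \<times> int) set" where
  "five_squares m = Sigma (odd_roots m) (\<lambda>w. four_squares (m - w\<^sup>2))"

lemma finite_three_squares: "finite (three_squares m)"
proof (rule finite_subset)
  show "three_squares m \<subseteq> {0..m} \<times> {0..m} \<times> {0..m}"
  proof
    fix s assume "s \<in> three_squares m"
    then obtain x y z where s: "s = (x, y, z)" "0 < x" "0 < y" "0 < z" "x\<^sup>2 + y\<^sup>2 + z\<^sup>2 = m"
      by (auto simp: three_squares_def)
    then show "s \<in> {0..m} \<times> {0..m} \<times> {0..m}"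
      using le_square[of x] le_square[of y] le_square[of z]
      by simp
  qed
qed simp

lemma finite_four_squares: "finite (four_squares m)"
  by (simp add: four_squares_def finite_odd_roots finite_three_squares)

lemma five_squares_iff:
  "(v, w, x, y, z) \<in> five_squares m
      \<longleftrightarrow> 0 < v \<and> 0 < w \<and> 0 < x \<and> 0 < y \<and> 0 < z \<and> odd v \<and> odd w \<and> odd x \<and> odd y \<and> odd z
    \<and> v\<^sup>2 + w\<^sup>2 + x\<^sup>2 + y\<^sup>2 + z\<^sup>2 = m"
proof -
  have "0 < s\<^sup>2 + t" if "0 < s" "0 \<le> t" for s t :: int
    using that by (simp add: add_pos_nonneg)
  then show ?thesis
    by (auto simp: five_squares_def four_squares_def three_squares_def odd_roots_def)
qed

text \<open>By symmetry each of the five squares has the same total over all representations, and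
  together they sum to \<open>m\<close> in each one.\<close>

lemma sum_five_squares:
  "(\<Sum>w\<in>odd_roots m. (m - 5 * w\<^sup>2) * int (card (four_squares (m - w\<^sup>2)))) = 0"
proof -
  let ?S = "\<lambda>f :: int \<Rightarrow> int \<Rightarrow> int \<Rightarrow> int \<Rightarrow> int \<Rightarrow> int. \<Sum>(v, w, x, y, z)\<in>five_squares m. f v w x y z"
  have "(\<Sum>w\<in>odd_roots m. (m - 5 * w\<^sup>2) * int (card (four_squares (m - w\<^sup>2))))
      = (\<Sum>w\<in>odd_roots m. \<Sum>s\<in>four_squares (m - w\<^sup>2). m - 5 * w\<^sup>2)"
    by (simp add: mult.commute)
  also have "\<dots> = ?S (\<lambda>v w x y z. m - 5 * v\<^sup>2)"
    unfolding five_squares_def case_prod_unfold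
    using sum.Sigma[OF finite_odd_roots, of m "\<lambda>w. four_squares (m - w\<^sup>2)"
        "\<lambda>w s. m - 5 * w\<^sup>2"] finite_four_squares
    by (simp add: case_prod_unfold)
  also have "\<dots> = ?S (\<lambda>v w x y z. v\<^sup>2 + w\<^sup>2 + x\<^sup>2 + y\<^sup>2 + z\<^sup>2 - 5 * v\<^sup>2)"
    by (rule sum.cong) (auto simp: five_squares_iff)
  also have "\<dots> = ?S (\<lambda>v w x y z. v\<^sup>2) + ?S (\<lambda>v w x y z. w\<^sup>2) + ?S (\<lambda>v w x y z. x\<^sup>2)
      + ?S (\<lambda>v w x y z. y\<^sup>2)
      + ?S (\<lambda>v w x y z. z\<^sup>2) - 5 * ?S (\<lambda>v w x y z. v\<^sup>2)"
    by (simp only: case_prod_unfold sum.distrib sum_subtractf sum_distrib_left)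
  also have "?S (\<lambda>v w x y z. w\<^sup>2) = ?S (\<lambda>v w x y z. v\<^sup>2)"
    by (rule sum.reindex_bij_witness[where i = "\<lambda>(v, w, x, y, z). (w, v, x, y, z)"
        and j = "\<lambda>(v, w, x, y, z). (w, v, x, y, z)"])
      (auto simp: five_squares_iff)
  also have "?S (\<lambda>v w x y z. x\<^sup>2) = ?S (\<lambda>v w x y z. v\<^sup>2)"
    by (rule sum.reindex_bij_witness[where i = "\<lambda>(v, w, x, y, z). (x, w, v, y, z)"
        and j = "\<lambda>(v, w, x, y, z). (x, w, v, y, z)"])
      (auto simp: five_squares_iff)
  also have "?S (\<lambda>v w x y z. y\<^sup>2) = ?S (\<lambda>v w x y z. v\<^sup>2)"
    by (rule sum.reindex_bij_witness[where i = "\<lambda>(v, w, x, y, z). (y, w, x, v, z)"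
        and j = "\<lambda>(v, w, x, y, z). (y, w, x, v, z)"])
      (auto simp: five_squares_iff)
  also have "?S (\<lambda>v w x y z. z\<^sup>2) = ?S (\<lambda>v w x y z. v\<^sup>2)"
    by (rule sum.reindex_bij_witness[where i = "\<lambda>(v, w, x, y, z). (z, w, x, y, v)"
        and j = "\<lambda>(v, w, x, y, z). (z, w, x, y, v)"])
      (auto simp: five_squares_iff)
  finally show ?thesis
    by (simp add: case_prod_unfold)
qed

lemma card_four_squares_4: "card (four_squares 4) = 1"
proof -
  have small: "t = 1" if "0 < t" "odd t" "t\<^sup>2 < 4" for t :: int
  proof -
    have "t < 2"
      using that(3) power2_less_imp_less[of t 2] by simp
    then show ?thesis
      using that(1) by linarith
  qed
  have "s = (1, 1, 1, 1)" if s: "s \<in> four_squares 4" for s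
  proof -
    obtain w x y z where *: "s = (w, x, y, z)" "0 < w" "0 < x" "0 < y" "0 < z" "odd w" "odd x"
        "odd y" "odd z"
      "w\<^sup>2 + x\<^sup>2 + y\<^sup>2 + z\<^sup>2 = 4"
      using s by (auto simp: four_squares_def three_squares_def odd_roots_def)
    have "0 < w\<^sup>2" "0 < x\<^sup>2" "0 < y\<^sup>2" "0 < z\<^sup>2"
      using *(2-5) by simp_all
    then have "w\<^sup>2 < 4" "x\<^sup>2 < 4" "y\<^sup>2 < 4" "z\<^sup>2 < 4"
      using *(10) by linarith+
    then show ?thesis
      using small[of w] small[of x] small[of y] small[of z] *(1-9) by blast
  qed
  moreover have "(1, 1, 1, 1) \<in> four_squares 4"
    by (simp add: four_squares_def three_squares_def odd_roots_def)
  ultimately have "four_squares 4 = {(1, 1, 1, 1)}"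
    by blast
  then show ?thesis
    by simp
qed

text \<open>Both sides satisfy the same recursion, whose leading coefficient is
  \<open>m - 4\<close>. It vanishes only at \<open>m = 4\<close>, where both sides are 1.\<close>

lemma card_four_squares:
  assumes "0 < m" "m mod 8 = 4"
  shows "int (card (four_squares m)) = divisor_sum (m div 4)"
proof -
  define F where "F m = int (card (four_squares m)) - divisor_sum (m div 4)" for m
  have "F m = 0"
  proof (rule square_recursion_zero[where F = F and m = m and c = "\<lambda>m w. m + 1 - 5 * w\<^sup>2"
      and r = 4])
    fix m :: int assume "0 < m" "m mod 8 = 4"
    then have m: "(m + 1) mod 8 = 5"
      by presburger
    have "(\<Sum>w\<in>odd_roots (m + 1). (m + 1 - 5 * w\<^sup>2) * F (m + 1 - w\<^sup>2))
      = (\<Sum>w\<in>odd_roots (m + 1). (m + 1 - 5 * w\<^sup>2) * int (card (four_squares (m + 1 - w\<^sup>2))))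
        - (\<Sum>w\<in>odd_roots (m + 1). (m + 1 - 5 * w\<^sup>2) * divisor_sum ((m + 1 - w\<^sup>2) div 4))"
      unfolding F_def by (simp only: right_diff_distrib[of "_ - _"] sum_subtractf)
    then show "(\<Sum>w\<in>odd_roots (m + 1). (m + 1 - 5 * w\<^sup>2) * F (m + 1 - w\<^sup>2)) = 0"
      unfolding divisor_sum_recursion[OF m] sum_five_squares by simp
  next
    fix m :: int assume "m + 1 - 5 * 1\<^sup>2 = 0"
    then have "m = 4"
      by simp
    moreover have "factor_pairs 1 = {(1, 1)}"
      by (auto simp: factor_pairs_def zmult_eq_1_iff)
    ultimately show "F m = 0"
      by (simp add: F_def divisor_sum_def card_four_squares_4)
  qed (use assms in auto)
  then show ?thesis
    by (simp add: F_def)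
qed

section \<open>Gauss's theorem on three odd squares\<close>

definition tri_products :: "int \<Rightarrow> (int \<times> int \<times> int) set" where
  "tri_products m = {(a, b, c). 0 < a \<and> 0 < b \<and> 0 < c \<and> odd a \<and> odd b \<and> odd c \<and> a * b + b * c
      + c * a = m}"

lemma square_tri_eq_Sigma: "square_tri m = Sigma (odd_roots m) (\<lambda>w. tri_products (m - w\<^sup>2))"
proof -
  have "0 < a * b + b * c + c * a" if "0 < a" "0 < b" "0 < c" for a b c :: int
    using that by (simp add: add_pos_pos)
  then show ?thesis
    by (force simp: square_tri_def odd_roots_def tri_products_def)
qed

lemma finite_tri_products: "finite (tri_products m)"
proof (rule finite_subset)
  show "tri_products m \<subseteq> snd ` square_tri (m + 1)"
  proof
    fix s assume "s \<in> tri_products m"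
    then have "(1, s) \<in> square_tri (m + 1)"
      by (auto simp: tri_products_def square_tri_def)
    then show "s \<in> snd ` square_tri (m + 1)"
      by force
  qed
qed (simp add: finite_square_tri)

text \<open>Summed over \<open>m + 1 - w^2\<close>, both counts give the divisor sum of
  \<open>(m + 1) div 4\<close>. All coefficients are 1, so the recursion has no exceptional
  case.\<close>

lemma card_three_squares:
  assumes "0 < m" "m mod 8 = 3"
  shows "card (three_squares m) = card (tri_products m)"
proof -
  have "int (card (three_squares m)) - int (card (tri_products m)) = 0"
  proof (rule square_recursion_zero[where F
      = "\<lambda>m. int (card (three_squares m)) - int (card (tri_products m))" and c = "\<lambda>m w. 1"
      and r = 3])
    fix m :: int assume m: "0 < m" "m mod 8 = 3"
    define k where "k = (m + 1) div 4"
    have k: "m + 1 = 4 * k" "odd k"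
      using m unfolding k_def by presburger+
    have "(\<Sum>w\<in>odd_roots (m + 1). int (card (three_squares (m + 1 - w\<^sup>2))))
        = int (card (four_squares (m + 1)))"
      by (simp add: four_squares_def card_SigmaI finite_odd_roots finite_three_squares)
    also have "\<dots> = divisor_sum k"
      using card_four_squares[of "m + 1"] m k by simp presburger
    also have "\<dots> = int (card (square_tri (m + 1)))"
      using card_square_tri[OF k(2)] by (simp add: divisor_sum_def k)
    also have "\<dots> = (\<Sum>w\<in>odd_roots (m + 1). int (card (tri_products (m + 1 - w\<^sup>2))))"
      by (simp add: square_tri_eq_Sigma card_SigmaI finite_odd_roots finite_tri_products)
    finally show "(\<Sum>w\<in>odd_roots (m + 1). 1 * (int (card (three_squares (m
        + 1 - w\<^sup>2))) - int (card (tri_products (m + 1 - w\<^sup>2))))) = 0"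
      by (simp add: sum_subtractf)
  qed (use assms in auto)
  then show ?thesis
    by simp
qed

theorem three_odd_squares:
  fixes m :: int
  assumes "0 < m" "m mod 8 = 3"
  obtains x y z where "odd x" "odd y" "odd z" "x\<^sup>2 + y\<^sup>2 + z\<^sup>2 = m"
proof -
  have "(1, 1, (m - 1) div 2) \<in> tri_products m"
    unfolding tri_products_def using assms by simp presburger
  then have "card (tri_products m) \<noteq> 0"
    using finite_tri_products[of m] by auto
  then have "three_squares m \<noteq> {}"
    using card_three_squares[OF assms] by auto
  then show ?thesis
    using that by (auto simp: three_squares_def)
qed

subsection \<open>Generalised polygonal numbers\<close>

text \<open>Cauchy's lemma. The numbers \<open>(t + x + y + z) / 4\<close>,
  \<open>(t + x - y - z) / 4\<close> and their two analogues have sum \<open>t\<close>, and their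
  squares add up to \<open>(t^2 + x^2 + y^2 + z^2) / 4 = s\<close>. Only their integrality needs an
  argument.\<close>

lemma four_squares_with_given_sum:
  fixes s t :: int
  assumes "odd s" "odd t" "t\<^sup>2 < 4 * s"
  obtains w x y z where "w + x + y + z = t" "w\<^sup>2 + x\<^sup>2 + y\<^sup>2 + z\<^sup>2 = s"
proof -
  have "(4 * s - t\<^sup>2) mod 8 = 3"
    using odd_square_mod_8[OF \<open>odd t\<close>] \<open>odd s\<close> by presburger
  then obtain x y z where xyz: "odd x" "odd y" "odd z" "x\<^sup>2 + y\<^sup>2 + z\<^sup>2 = 4 * s - t\<^sup>2"
    using three_odd_squares[of "4 * s - t\<^sup>2"] assms(3) by auto
  \<comment> \<open>A sum of four odd numbers is even, and changing the sign of \<open>x\<close>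
    alters it by 2 modulo 4.\<close>
  obtain x' where x': "odd x'" "x'\<^sup>2 = x\<^sup>2" "4 dvd t + x' + y + z"
  proof (cases "4 dvd t + x + y + z")
    case True
    then show ?thesis using that xyz by blast
  next
    case False
    then have "4 dvd t + (- x) + y + z"
      using xyz \<open>odd t\<close> by presburger
    then show ?thesis using that[of "- x"] xyz by simp
  qed
  obtain u where u: "t + x' + y + z = 4 * u"
    using x' by (elim dvdE)
  obtain v where v: "y + z = 2 * v"
    using xyz by (metis evenE odd_even_add)
  obtain v' where v': "x' + z = 2 * v'"
    using xyz x' by (metis evenE odd_even_add)
  obtain v'' where v'': "x' + y = 2 * v''"
    using xyz x' by (metis evenE odd_even_add)
  have eqs: "x' = v' + v'' - v" "y = v + v'' - v'" "z = v + v' - v''" "t = 4 * u - v - v' - v''"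
    using u v v' v'' by linarith+
  show ?thesis
  proof (rule that[of u "u - v" "u - v'" "u - v''"])
    show "u + (u - v) + (u - v') + (u - v'') = t"
      using eqs by simp
    have "4 * (u\<^sup>2 + (u - v)\<^sup>2 + (u - v')\<^sup>2 + (u - v'')\<^sup>2) = t\<^sup>2 + (x'\<^sup>2 + y\<^sup>2 + z\<^sup>2)"
      unfolding eqs by (simp add: power2_eq_square algebra_simps)
    then show "u\<^sup>2 + (u - v)\<^sup>2 + (u - v')\<^sup>2 + (u - v'')\<^sup>2 = s"
      using x' xyz by simp
  qed
qed

definition polygonal :: "int \<Rightarrow> int \<Rightarrow> int \<Rightarrow> int" where
  "polygonal a b w = w * (a * w + b) div 2"

lemma S_eq: "S a b = {polygonal a b w + polygonal a b x + polygonal a b y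
    + polygonal a b z | w x y z. True}"
  by (simp add: S_def polygonal_def)

lemma double_polygonal: "odd a \<Longrightarrow> odd b \<Longrightarrow> 2 * polygonal a b w = a * w\<^sup>2 + b * w"
proof -
  assume "odd a" "odd b"
  then have "even (w * (a * w + b))"
    by simp
  then show ?thesis
    by (simp add: polygonal_def power2_eq_square algebra_simps)
qed

text \<open>As \<open>c\<close> inverts \<open>b\<close> modulo \<open>a\<close>, choosing
  \<open>t\<close> congruent to \<open>2 * n * c\<close> makes \<open>2 * n - b * t\<close> a
  multiple \<open>a * s\<close>. The size condition gives \<open>4 * a * s \<ge> 8 * n - 4 *
  \<bar>b\<bar> * a > a ^ 3 \<ge> a * t^2\<close>, so Cauchy's lemma applies.\<close>

lemma in_S_if_large:
  assumes "odd a" "odd b" "0 < a" "a dvd b * c - 1" "a ^ 3 + 4 * \<bar>b\<bar> * a < 8 * n"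
  shows "n \<in> S a b"
proof -
  define r where "r = 2 * n * c mod a"
  \<comment> \<open>Since \<open>a\<close> is odd, exactly one of \<open>r\<close> and
    \<open>r - a\<close> is odd, and both have absolute value at most \<open>a\<close>.\<close>
  define t where "t = (if odd r then r else r - a)"
  have r: "0 \<le> r" "r < a" "a dvd 2 * n * c - r"
    using \<open>0 < a\<close> by (auto simp: r_def mod_eq_dvd_iff[symmetric])
  have t: "odd t" "\<bar>t\<bar> \<le> a" "a dvd 2 * n * c - t"
    using r \<open>odd a\<close> by (auto simp: t_def dvd_diff_right_iff algebra_simps)
  have "a dvd 2 * n - b * t"
  proof -
    have "2 * n - b * t = b * (2 * n * c - t) - 2 * n * (b * c - 1)"
      by (simp add: algebra_simps)
    then show ?thesis
      using t(3) assms(4) by simp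
  qed
  then obtain s where s: "2 * n - b * t = a * s"
    by (elim dvdE)
  have "odd (a * s)"
    using t(1) \<open>odd b\<close> unfolding s[symmetric] by simp
  then have "odd s"
    by simp
  have "\<bar>b * t\<bar> \<le> \<bar>b\<bar> * a"
    using t(2) by (simp add: abs_mult mult_left_mono)
  moreover have "a * t\<^sup>2 \<le> a ^ 3"
  proof -
    have "t\<^sup>2 \<le> a\<^sup>2"
      using t(2) \<open>0 < a\<close> by (simp add: abs_le_square_iff[symmetric])
    then show ?thesis
      using \<open>0 < a\<close> by (simp add: power3_eq_cube power2_eq_square mult.assoc)
  qed
  ultimately have "a * t\<^sup>2 < a * (4 * s)"
    using s assms(5) by (simp add: algebra_simps)
  then have "t\<^sup>2 < 4 * s"
    using \<open>0 < a\<close> by simp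
  from four_squares_with_given_sum[OF \<open>odd s\<close> t(1) this]
  obtain w x y z where wxyz: "w + x + y + z = t" "w\<^sup>2 + x\<^sup>2 + y\<^sup>2 + z\<^sup>2 = s" .
  have "2 * n = 2 * (polygonal a b w + polygonal a b x + polygonal a b y + polygonal a b z)"
    using s unfolding wxyz[symmetric] distrib_left double_polygonal[OF assms(1,2)]
    by (simp add: algebra_simps)
  then have "n = polygonal a b w + polygonal a b x + polygonal a b y + polygonal a b z"
    by simp
  then show ?thesis
    unfolding S_eq by blast
qed

section \<open>Direct check of the remaining small numbers\<close>

definition pair_sums :: "int \<Rightarrow> int \<Rightarrow> int list" where
  "pair_sums a b = remdups [polygonal a b w + polygonal a b x. w \<leftarrow> [-5..5], x \<leftarrow> [-5..5]]"

definition missing :: "int \<Rightarrow> int \<Rightarrow> int \<Rightarrow> int list" where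
  "missing a b m = (let L = filter (\<lambda>s. s \<le> m) (pair_sums a b) in
     filter (\<lambda>n. list_all (\<lambda>s. \<not> List.member L (n - s)) L) [0..m])"

lemma set_pair_sums:
  "set (pair_sums a b) = {polygonal a b w + polygonal a b x | w x. w \<in> {-5..5} \<and> x \<in> {-5..5}}"
  unfolding pair_sums_def set_remdups set_concat set_map set_upto image_image by blast

text \<open>Replacing \<open>b * w\<close> by its least possible value leaves
  \<open>k * (a * k - \<bar>b\<bar>)\<close> at \<open>k = \<bar>w\<bar>\<close>, which is monotone
  over the integers \<open>k \<ge> 0\<close> because \<open>\<bar>b\<bar> < a\<close>. The case
  \<open>k = 0\<close> gives nonnegativity, and \<open>k = 6\<close> bounds the search
  range.\<close>

lemma polygonal_ge:
  assumes "odd a" "odd b" "\<bar>b\<bar> < a" "0 \<le> k" "k \<le> \<bar>w\<bar>"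
  shows "k * (a * k - \<bar>b\<bar>) \<le> 2 * polygonal a b w"
proof -
  have "- (\<bar>b\<bar> * \<bar>w\<bar>) \<le> b * w"
    using abs_le_iff[of "b * w" "\<bar>b\<bar> * \<bar>w\<bar>"] by (simp add: abs_mult)
  then have "\<bar>w\<bar> * (a * \<bar>w\<bar> - \<bar>b\<bar>) \<le> 2 * polygonal a b w"
    unfolding double_polygonal[OF assms(1,2)] by (simp add: algebra_simps power2_eq_square flip:
        abs_mult)
  moreover have "k * (a * k - \<bar>b\<bar>) \<le> \<bar>w\<bar> * (a * \<bar>w\<bar> - \<bar>b\<bar>)"
  proof (cases "k = 0")
    case True
    have "\<bar>b\<bar> \<le> a * \<bar>w\<bar>" if "w \<noteq> 0"
      using mult_mono[of "\<bar>b\<bar>" a 1 "\<bar>w\<bar>"] that assms(3) by simp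
    then show ?thesis
      using True by (cases "w = 0") simp_all
  next
    case False
    have "\<bar>b\<bar> \<le> a * k"
      using mult_mono[of "\<bar>b\<bar>" a 1 k] False assms(3,4) by simp
    moreover have "a * k \<le> a * \<bar>w\<bar>"
      using assms(3,5) by (intro mult_left_mono) auto
    ultimately show ?thesis
      using assms(4,5) by (intro mult_mono) auto
  qed
  ultimately show ?thesis
    by linarith
qed

text \<open>The bound on \<open>m\<close> forces every argument into \<open>{-5..5}\<close>. As all
  terms are nonnegative, each of the two pair sums making up \<open>n\<close> is at most
  \<open>m\<close>, so the filter in \<open>missing\<close> loses nothing.\<close>

lemma small_in_S_iff:
  assumes "odd a" "odd b" "\<bar>b\<bar> < a" "2 * m < 6 * (a * 6 - \<bar>b\<bar>)" "0 \<le> n" "n \<le> m"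
  shows "n \<in> S a b \<longleftrightarrow> n \<notin> set (missing a b m)"
proof -
  let ?L = "filter (\<lambda>s. s \<le> m) (pair_sums a b)"
  have nonneg: "0 \<le> polygonal a b w" for w
    using polygonal_ge[OF assms(1-3), of 0 w] by simp
  have small: "w \<in> {-5..5}" if "polygonal a b w \<le> m" for w
  proof (rule ccontr)
    assume "w \<notin> {-5..5}"
    then have "6 \<le> \<bar>w\<bar>"
      by auto
    then show False
      using polygonal_ge[OF assms(1-3), of 6 w] that assms(4) by linarith
  qed
  have "n \<in> S a b \<longleftrightarrow> (\<exists>s\<in>set ?L. n - s \<in> set ?L)"
  proof
    assume "n \<in> S a b"
    then obtain w x y z where "n = polygonal a b w + polygonal a b x + polygonal a b y
        + polygonal a b z"
      unfolding S_eq by blast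
    then have n: "n = (polygonal a b w + polygonal a b x) + (polygonal a b y + polygonal a b z)"
      by linarith
    have le: "polygonal a b w \<le> m" "polygonal a b x \<le> m" "polygonal a b y \<le> m" "polygonal a b z \<le> m"
        "polygonal a b w + polygonal a b x \<le> m" "polygonal a b y + polygonal a b z \<le> m"
      using n nonneg[of w] nonneg[of x] nonneg[of y] nonneg[of z] assms(6) by linarith+
    then have "polygonal a b w + polygonal a b x \<in> set ?L"
        "polygonal a b y + polygonal a b z \<in> set ?L"
      using small unfolding set_filter set_pair_sums by blast+
    then show "\<exists>s\<in>set ?L. n - s \<in> set ?L"
      using n by (metis add_diff_cancel_left')
  next
    assume "\<exists>s\<in>set ?L. n - s \<in> set ?L"
    then obtain s where "s \<in> set (pair_sums a b)" "n - s \<in> set (pair_sums a b)"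
      by auto
    then obtain w x y z where "s = polygonal a b w + polygonal a b x"
        "n - s = polygonal a b y + polygonal a b z"
      unfolding set_pair_sums by blast
    then have "n = polygonal a b w + polygonal a b x + polygonal a b y + polygonal a b z"
      by linarith
    then show "n \<in> S a b"
      unfolding S_eq by blast
  qed
  also have "\<dots> \<longleftrightarrow> n \<notin> set (missing a b m)"
    using assms(5,6) by (auto simp: missing_def Let_def list_all_iff)
  finally show ?thesis .
qed

lemma S_eq_if_missing:
  assumes "odd a" "odd b" "\<bar>b\<bar> < a" "a dvd b * c - 1"
    and "a ^ 3 + 4 * \<bar>b\<bar> * a < 8 * (m + 1)" "2 * m < 6 * (a * 6 - \<bar>b\<bar>)" "missing a b m = xs"
  shows "S a b = \<nat> - set xs"
proof (rule set_eqI)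
  fix n
  consider "n < 0" | "0 \<le> n" "n \<le> m" | "0 \<le> n" "m < n"
    by linarith
  then show "n \<in> S a b \<longleftrightarrow> n \<in> \<nat> - set xs"
  proof cases
    case 1
    have "0 \<le> polygonal a b w" for w
      using polygonal_ge[OF assms(1-3), of 0 w] by simp
    then have "0 \<le> x" if "x \<in> S a b" for x
      using that unfolding S_eq by (auto intro!: add_nonneg_nonneg)
    then have "n \<notin> S a b"
      using 1 by (meson not_le)
    then show ?thesis
      using 1 by (auto simp: Nats_altdef1)
  next
    case 2
    then show ?thesis
      using small_in_S_iff[OF assms(1-3,6)] assms(7) by (auto simp: Nats_altdef1)
  next
    case 3
    then have "n \<in> S a b"
      using assms by (intro in_S_if_large[of a b c]) auto
    moreover have "set xs \<subseteq> {0..m}"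
      unfolding assms(7)[symmetric] missing_def Let_def by auto
    ultimately show ?thesis
      using 3 by (auto simp: Nats_altdef1)
  qed
qed

text \<open>Each \<open>m\<close> satisfies
  \<open>a ^ 3 + 4 * \<bar>b\<bar> * a < 8 * (m + 1)\<close>, so the check reaches the range of
  \<open>in_S_if_large\<close>. For \<open>a = 9\<close> it is the least such \<open>m\<close>. For
  \<open>a = 7\<close> the value 60, least for \<open>b = 5\<close>, serves all three
  \<open>b\<close>.\<close>

lemma missing_eqs:
  "missing 7 1 60 = [1, 2, 5]"
  "missing 7 3 60 = [1, 3, 25]"
  "missing 7 5 60 = [5, 23]"
  "missing 9 1 95 = [1, 2, 3, 6, 7, 11, 35, 37]"
  "missing 9 5 113 = [1, 3, 5, 10, 12, 31, 67]"
  "missing 9 7 122 = [5, 6, 7, 15, 29, 65]"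
  apply code_simp+
  done

theorem corollary3:
  shows "S 7 1 = \<nat> - {1, 2, 5}
    \<and> S 7 3 = \<nat> - {1, 3, 25}
    \<and> S 7 5 = \<nat> - {5, 23}
    \<and> S 9 1 = \<nat> - {1, 2, 3, 6, 7, 11, 35, 37}
    \<and> S 9 5 = \<nat> - {1, 3, 5, 10, 12, 31, 67}
    \<and> S 9 7 = \<nat> - {5, 6, 7, 15, 29, 65}"
proof -
  \<comment> \<open>In each case \<open>c\<close> is the inverse of \<open>b\<close> modulo
    \<open>a\<close>.\<close>
  have "S 7 1 = \<nat> - set [1, 2, 5]"
    by (intro S_eq_if_missing[where c = 1 and m = 60]) (simp_all add: missing_eqs)
  moreover have "S 7 3 = \<nat> - set [1, 3, 25]"
    by (intro S_eq_if_missing[where c = 5 and m = 60]) (simp_all add: missing_eqs)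
  moreover have "S 7 5 = \<nat> - set [5, 23]"
    by (intro S_eq_if_missing[where c = 3 and m = 60]) (simp_all add: missing_eqs)
  moreover have "S 9 1 = \<nat> - set [1, 2, 3, 6, 7, 11, 35, 37]"
    by (intro S_eq_if_missing[where c = 1 and m = 95]) (simp_all add: missing_eqs)
  moreover have "S 9 5 = \<nat> - set [1, 3, 5, 10, 12, 31, 67]"
    by (intro S_eq_if_missing[where c = 2 and m = 113]) (simp_all add: missing_eqs)
  moreover have "S 9 7 = \<nat> - set [5, 6, 7, 15, 29, 65]"
    by (intro S_eq_if_missing[where c = 4 and m = 122]) (simp_all add: missing_eqs)
  ultimately show ?thesis
    by simp
qed

end
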